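(* Let $K$ be an algebraically closed field of characteristic zero, let $K[x]=K[x_1,\ldots,x_n]$, and let $D=\sum_{i=1}^n(a_ix_i+b_i(x_1,\ldots,x_{i-1}))\partial_i$ be a derivation of $K[x]$ with $a_i\in K$ and $b_i\in K[x_1,\ldots,x_{i-1}]$ for all $1\leq i\leq n$ (so $b_1\in K$). Let $S$ be the set of nonzero integral solutions $(y_1,\ldots,y_n)\in\mathbb{Z}^n$ of the linear equation $\sum_{i=1}^na_iy_i=0$. If $S=\emptyset$, then $\operatorname{Im}D$ is an ideal of $K[x]$.
   Context: $\partial_i=\frac{\partial}{\partial x_i}$, and $\operatorname{Im}D=D(K[x])$. *)

theory Defs
  imports
    "HOL-Library.Poly_Mapping"
    "HOL-Computational_Algebra.Polynomial"
    "HOL-Algebra.Ideal"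
begin

text \<open>
  A monomial is its finitely supported exponent vector, and a polynomial maps monomials to
  coefficients. The type \<open>'k mpol\<close> has a variable \<open>x\<^sub>i\<close> for every natural number \<open>i\<close>;
  \<open>K[x\<^sub>1,\<dots>,x\<^sub>n]\<close> is the set of polynomials involving only variables with index in \<open>{1..n}\<close>.
\<close>

type_synonym 'k mpol = "(nat \<Rightarrow>\<^sub>0 nat) \<Rightarrow>\<^sub>0 'k"

definition mconst :: "'k::comm_ring_1 \<Rightarrow> 'k mpol" where
  "mconst c = Poly_Mapping.single 0 c"

definition mvar :: "nat \<Rightarrow> 'k::comm_ring_1 mpol" where
  "mvar i = Poly_Mapping.single (Poly_Mapping.single i 1) 1"

definition polys_in :: "nat set \<Rightarrow> 'k::comm_ring_1 mpol set" where
  "polys_in V = {p. \<forall>m \<in> Poly_Mapping.keys p. Poly_Mapping.keys m \<subseteq> V}"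

definition mpoly_ring :: "nat \<Rightarrow> 'k::comm_ring_1 mpol ring" where
  "mpoly_ring n =
     \<lparr>carrier = polys_in {1..n}, mult = (*), one = 1, zero = 0, add = (+)\<rparr>"

text \<open>
  If \<open>x\<^sub>i\<close> does not occur in \<open>m\<close>, the truncated exponent in \<open>m - single i 1\<close> is harmless,
  since the coefficient is then zero.
\<close>

definition partial :: "nat \<Rightarrow> 'k::comm_ring_1 mpol \<Rightarrow> 'k mpol" where
  "partial i p = (\<Sum>m \<in> Poly_Mapping.keys p.
     Poly_Mapping.single (m - Poly_Mapping.single i 1)
       (of_nat (Poly_Mapping.lookup m i) * Poly_Mapping.lookup p m))"

text \<open>
  Vectors \<open>(y\<^sub>1,\<dots>,y\<^sub>n)\<close> of integers are functions on \<open>{1..n}\<close>, extended by \<open>undefined\<close>.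
\<close>

definition nonzero_int_solutions :: "nat \<Rightarrow> (nat \<Rightarrow> 'k::comm_ring_1) \<Rightarrow> (nat \<Rightarrow> int) set" where
  "nonzero_int_solutions n a =
     {y \<in> {1..n} \<rightarrow>\<^sub>E UNIV. (\<exists>i\<in>{1..n}. y i \<noteq> 0) \<and> (\<Sum>i=1..n. a i * of_int (y i)) = 0}"

lemma polys_in_times:
  assumes "p \<in> polys_in V" "q \<in> polys_in V"
  shows "p * q \<in> polys_in V"
proof -
  have "Poly_Mapping.keys m \<subseteq> V" if m: "m \<in> Poly_Mapping.keys (p * q)" for m
  proof -
    from m obtain u v where "m = u + v" "u \<in> Poly_Mapping.keys p" "v \<in> Poly_Mapping.keys q"
      using keys_mult[of p q] by blast
    with assms show ?thesis
      using Poly_Mapping.keys_add[of u v] unfolding polys_in_def by blast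
  qed
  then show ?thesis by (auto simp: polys_in_def)
qed

lemma polys_in_plus: "p \<in> polys_in V \<Longrightarrow> q \<in> polys_in V \<Longrightarrow> p + q \<in> polys_in V"
  using Poly_Mapping.keys_add[of p q] by (fastforce simp: polys_in_def)

lemma polys_in_uminus: "p \<in> polys_in V \<Longrightarrow> - p \<in> polys_in V"
  by (simp add: polys_in_def)

lemma polys_in_zero: "0 \<in> polys_in V"
  by (simp add: polys_in_def)

lemma polys_in_one: "1 \<in> polys_in V"
  by (simp add: polys_in_def)

lemma polys_in_single: "Poly_Mapping.keys m \<subseteq> V \<Longrightarrow> Poly_Mapping.single m c \<in> polys_in V"
  by (simp add: polys_in_def)

lemma cring_mpoly_ring: "cring (mpoly_ring n :: 'k::comm_ring_1 mpol ring)"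
proof (rule cringI)
  show "abelian_group (mpoly_ring n :: 'k mpol ring)"
  proof (rule abelian_groupI)
    fix p :: "'k mpol" assume "p \<in> carrier (mpoly_ring n)"
    then show "\<exists>q\<in>carrier (mpoly_ring n). q \<oplus>\<^bsub>mpoly_ring n\<^esub> p = \<zero>\<^bsub>mpoly_ring n\<^esub>"
      by (intro bexI[of _ "- p"]) (auto simp: mpoly_ring_def polys_in_uminus)
  qed (auto simp: mpoly_ring_def polys_in_plus polys_in_zero algebra_simps)
  show "comm_monoid (mpoly_ring n :: 'k mpol ring)"
    by (rule comm_monoidI)
      (auto simp: mpoly_ring_def polys_in_times polys_in_one algebra_simps)
qed (auto simp: mpoly_ring_def algebra_simps)

lemma partial_superset:
  assumes "finite A" "Poly_Mapping.keys p \<subseteq> A"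
  shows "partial i p = (\<Sum>m \<in> A. Poly_Mapping.single (m - Poly_Mapping.single i 1)
       (of_nat (Poly_Mapping.lookup m i) * Poly_Mapping.lookup p m))"
  unfolding partial_def using assms
  by (intro sum.mono_neutral_left) (auto simp: in_keys_iff)

lemma partial_add: "partial i (p + q) = partial i p + partial i q"
proof -
  let ?A = "Poly_Mapping.keys p \<union> Poly_Mapping.keys q"
  have "Poly_Mapping.keys (p + q) \<subseteq> ?A" by (rule Poly_Mapping.keys_add)
  then show ?thesis
    by (simp add: partial_superset[of ?A] lookup_add algebra_simps single_add sum.distrib)
qed

lemma partial_single:
  "partial i (Poly_Mapping.single m c) =
     Poly_Mapping.single (m - Poly_Mapping.single i 1) (of_nat (Poly_Mapping.lookup m i) * c)"
  using partial_superset[of "{m}" "Poly_Mapping.single m c" i] by simp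

lemma partial_mconst: "partial i (mconst c) = 0"
  by (simp add: mconst_def partial_single)

lemma partial_mvar: "partial i (mvar j) = (if i = j then 1 else 0)"
  by (simp add: mvar_def partial_single lookup_single when_def)

lemma mpol_induct [case_names single sum]:
  fixes p :: "'k::comm_ring_1 mpol"
  assumes "\<And>m c. P (Poly_Mapping.single m c)"
    and sum: "\<And>p q. P p \<Longrightarrow> P q \<Longrightarrow> P (p + q)"
  shows "P p"
proof (induction p rule: update_induct)
  case const
  show ?case using assms(1)[of 0 0] by simp
next
  case (update f m c)
  have "Poly_Mapping.update m c f = f + Poly_Mapping.single m c"
    using update(1)
    by (intro poly_mapping_eqI)
      (auto simp: lookup_update lookup_add lookup_single when_def in_keys_iff)
  then show ?case using sum[OF update(3) assms(1)] by simp
qed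

lemma partial_mult: "partial i (p * q) = partial i p * q + p * partial i q"
proof (induction p rule: mpol_induct)
  case (single u c)
  show ?case
  proof (induction q rule: mpol_induct)
    case (single v d)
    let ?e = "Poly_Mapping.single i (1::nat)"
    have shift: "s - ?e + t = s + t - ?e" if "Poly_Mapping.lookup s i \<noteq> 0" for s t
      using that by (intro poly_mapping_eqI) (auto simp: lookup_add lookup_minus lookup_single when_def)
    have left: "Poly_Mapping.single (u - ?e + v) (of_nat (Poly_Mapping.lookup u i) * (c * d)) =
        Poly_Mapping.single (u + v - ?e) (of_nat (Poly_Mapping.lookup u i) * (c * d))"
      using shift[of u v] by (cases "Poly_Mapping.lookup u i = 0") auto
    have right: "Poly_Mapping.single (u + (v - ?e)) (of_nat (Poly_Mapping.lookup v i) * (c * d)) =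
        Poly_Mapping.single (u + v - ?e) (of_nat (Poly_Mapping.lookup v i) * (c * d))"
      using shift[of v u] by (cases "Poly_Mapping.lookup v i = 0") (auto simp: add.commute)
    show ?case
      using left right
      by (simp add: partial_single mult_single lookup_add algebra_simps flip: single_add)
  next
    case (sum p q)
    then show ?case by (simp add: partial_add algebra_simps)
  qed
next
  case (sum p q)
  then show ?case by (simp add: partial_add algebra_simps)
qed

end

theory Submission
  imports Defs
begin

text \<open>
  The vector field \<open>(a\<^sub>i x\<^sub>i + b\<^sub>i)\<^sub>i\<close> has a zero \<open>P \<in> K\<^sup>n\<close>: every \<open>a\<^sub>i\<close> is nonzero, since
  otherwise the \<open>i\<close>-th unit vector would be an integral solution, so the triangular system
  \<open>a\<^sub>i P\<^sub>i + b\<^sub>i(P\<^sub>1, \<dots>, P\<^bsub>i-1\<^esub>) = 0\<close> is solved one coordinate at a time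
  (\<open>triangular_field_has_zero\<close>). The image of \<open>D\<close> turns out to be exactly the maximal ideal of
  polynomials vanishing at \<open>P\<close>.

  One inclusion is clear, because all coefficients of \<open>D\<close> vanish at \<open>P\<close>
  (\<open>eval_at_triangular_derivation\<close>). For the other, order monomials lexicographically with
  \<open>x\<^sub>n\<close> most significant. Then \<open>D\<close> is triangular on monomials: \<open>D x\<^sup>m\<close> is
  \<open>(\<Sum>\<^sub>i a\<^sub>i m\<^sub>i) x\<^sup>m\<close> plus smaller terms (\<open>triangular_derivation_single\<close>). If there are no nonzero
  integral solutions, the diagonal entry vanishes for \<open>m = 0\<close> only, so induction on \<open>m\<close> gives
  \<open>K[x] = Im D + K\<close> (\<open>constant_modulo_image\<close>). Writing \<open>f = D g + c\<close> and
  evaluating at \<open>P\<close> yields \<open>c = f(P)\<close>, so \<open>f\<close> is in the image as soon as \<open>f(P) = 0\<close>.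
\<close>

section \<open>Evaluation at a point\<close>

definition monom_at :: "(nat \<Rightarrow> 'k::comm_ring_1) \<Rightarrow> (nat \<Rightarrow>\<^sub>0 nat) \<Rightarrow> 'k" where
  "monom_at P m = (\<Prod>i \<in> Poly_Mapping.keys m. P i ^ Poly_Mapping.lookup m i)"

definition eval_at :: "(nat \<Rightarrow> 'k::comm_ring_1) \<Rightarrow> 'k mpol \<Rightarrow> 'k" where
  "eval_at P p = (\<Sum>m \<in> Poly_Mapping.keys p. Poly_Mapping.lookup p m * monom_at P m)"

lemma monom_at_superset:
  assumes "finite A" "Poly_Mapping.keys m \<subseteq> A"
  shows "monom_at P m = (\<Prod>i \<in> A. P i ^ Poly_Mapping.lookup m i)"
  unfolding monom_at_def using assms
  by (intro prod.mono_neutral_left) (auto simp: in_keys_iff)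

lemma monom_at_add: "monom_at P (u + v) = monom_at P u * monom_at P v"
proof -
  let ?A = "Poly_Mapping.keys u \<union> Poly_Mapping.keys v"
  have "Poly_Mapping.keys (u + v) \<subseteq> ?A" by (rule Poly_Mapping.keys_add)
  then show ?thesis
    by (simp add: monom_at_superset[of ?A] lookup_add power_add prod.distrib)
qed

lemma eval_at_superset:
  assumes "finite A" "Poly_Mapping.keys p \<subseteq> A"
  shows "eval_at P p = (\<Sum>m \<in> A. Poly_Mapping.lookup p m * monom_at P m)"
  unfolding eval_at_def using assms
  by (intro sum.mono_neutral_left) (auto simp: in_keys_iff)

lemma eval_at_add: "eval_at P (p + q) = eval_at P p + eval_at P q"
proof -
  let ?A = "Poly_Mapping.keys p \<union> Poly_Mapping.keys q"
  have "Poly_Mapping.keys (p + q) \<subseteq> ?A" by (rule Poly_Mapping.keys_add)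
  then show ?thesis
    by (simp add: eval_at_superset[of ?A] lookup_add algebra_simps sum.distrib)
qed

lemma eval_at_zero: "eval_at P 0 = 0"
  by (simp add: eval_at_def)

lemma eval_at_sum: "eval_at P (\<Sum>i\<in>I. f i) = (\<Sum>i\<in>I. eval_at P (f i))"
  by (induction I rule: infinite_finite_induct) (simp_all add: eval_at_zero eval_at_add)

lemma eval_at_single: "eval_at P (Poly_Mapping.single m c) = c * monom_at P m"
  using eval_at_superset[of "{m}" "Poly_Mapping.single m c" P] by simp

lemma eval_at_mult: "eval_at P (p * q) = eval_at P p * eval_at P q"
proof (induction p rule: mpol_induct)
  case (single u c)
  show ?case
    by (induction q rule: mpol_induct)
      (simp_all add: mult_single eval_at_single monom_at_add eval_at_add algebra_simps)
next
  case (sum p q)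
  then show ?case by (simp add: eval_at_add algebra_simps)
qed

lemma eval_at_uminus: "eval_at P (- p) = - eval_at P p"
  using eval_at_add[of P p "- p"] by (simp add: eval_at_zero eq_neg_iff_add_eq_0 add.commute)

lemma eval_at_mconst: "eval_at P (mconst c) = c"
  by (simp add: mconst_def eval_at_single monom_at_def)

lemma eval_at_mvar: "eval_at P (mvar i) = P i"
  by (simp add: mvar_def eval_at_single monom_at_def)

lemma eval_at_cong:
  assumes "p \<in> polys_in V" "\<And>i. i \<in> V \<Longrightarrow> P i = Q i"
  shows "eval_at P p = eval_at Q p"
proof -
  have "monom_at P m = monom_at Q m" if "m \<in> Poly_Mapping.keys p" for m
    unfolding monom_at_def using that assms
    by (intro prod.cong refl arg_cong[where f = "\<lambda>c. c ^ _"] assms(2)) (auto simp: polys_in_def)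
  then show ?thesis by (simp add: eval_at_def)
qed

lemma vanishing_ideal:
  "ideal {f \<in> carrier (mpoly_ring n). eval_at P f = 0} (mpoly_ring n :: 'k::comm_ring_1 mpol ring)"
  (is "ideal ?I ?R")
proof -
  interpret cring ?R by (rule cring_mpoly_ring)
  have minus: "\<ominus>\<^bsub>?R\<^esub> f = - f" if "f \<in> carrier ?R" for f
    using that by (intro minus_equality) (auto simp: mpoly_ring_def polys_in_uminus)
  show ?thesis
  proof (rule idealI)
    show "subgroup ?I (add_monoid ?R)"
    proof (rule add.subgroupI)
      show "?I \<noteq> {}" by (auto simp: mpoly_ring_def intro!: exI[of _ 0] polys_in_zero eval_at_zero)
    next
      fix f assume "f \<in> ?I"
      then show "\<ominus>\<^bsub>?R\<^esub> f \<in> ?I"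
        using minus by (simp add: mpoly_ring_def polys_in_uminus eval_at_uminus)
    qed (auto simp: mpoly_ring_def polys_in_plus eval_at_add)
  qed (rule ring_axioms, auto simp: mpoly_ring_def polys_in_times eval_at_mult)
qed

section \<open>Triangular derivations\<close>

definition triangular_derivation ::
    "nat \<Rightarrow> (nat \<Rightarrow> 'k::comm_ring_1) \<Rightarrow> (nat \<Rightarrow> 'k mpol) \<Rightarrow> 'k mpol \<Rightarrow> 'k mpol" where
  "triangular_derivation n a b f = (\<Sum>i=1..n. (mconst (a i) * mvar i + b i) * partial i f)"

lemma triangular_derivation_add:
  "triangular_derivation n a b (f + g) = triangular_derivation n a b f + triangular_derivation n a b g"
  by (simp add: triangular_derivation_def partial_add distrib_left sum.distrib)

lemma triangular_derivation_zero: "triangular_derivation n a b 0 = 0"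
  by (simp add: triangular_derivation_def partial_def)

lemma triangular_derivation_uminus:
  "triangular_derivation n a b (- f) = - triangular_derivation n a b f"
  using triangular_derivation_add[of n a b f "- f"]
  by (simp add: triangular_derivation_zero eq_neg_iff_add_eq_0 add.commute)

lemma polys_in_sum: "(\<And>i. i \<in> I \<Longrightarrow> f i \<in> polys_in V) \<Longrightarrow> (\<Sum>i\<in>I. f i) \<in> polys_in V"
  by (induction I rule: infinite_finite_induct) (simp_all add: polys_in_zero polys_in_plus)

lemma polys_in_mono: "V \<subseteq> W \<Longrightarrow> p \<in> polys_in V \<Longrightarrow> p \<in> polys_in W"
  by (auto simp: polys_in_def)

lemma polys_in_partial:
  assumes "p \<in> polys_in V"
  shows "partial i p \<in> polys_in V"
proof -
  have "Poly_Mapping.keys (m - Poly_Mapping.single i 1) \<subseteq> Poly_Mapping.keys m"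
    for m :: "nat \<Rightarrow>\<^sub>0 nat"
    by (auto simp: in_keys_iff lookup_minus)
  with assms show ?thesis
    unfolding partial_def by (intro polys_in_sum polys_in_single) (auto simp: polys_in_def)
qed

lemma polys_in_triangular_derivation:
  assumes "\<And>i. i \<in> {1..n} \<Longrightarrow> b i \<in> polys_in {1..i - 1}" "f \<in> polys_in {1..n}"
  shows "triangular_derivation n a b f \<in> polys_in {1..n}"
  unfolding triangular_derivation_def
proof (rule polys_in_sum)
  fix i assume i: "i \<in> {1..n}"
  then have "b i \<in> polys_in {1..n}"
    by (intro polys_in_mono[OF _ assms(1)[OF i]]) auto
  with i assms(2) show "(mconst (a i) * mvar i + b i) * partial i f \<in> polys_in {1..n}"
    unfolding mconst_def mvar_def
    by (intro polys_in_times polys_in_plus polys_in_partial polys_in_single) auto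
qed

lemma triangular_field_has_zero:
  fixes a :: "nat \<Rightarrow> 'k::field"
  assumes b: "\<And>i. i \<in> {1..n} \<Longrightarrow> b i \<in> polys_in {1..i - 1}"
    and a: "\<And>i. i \<in> {1..n} \<Longrightarrow> a i \<noteq> 0"
  shows "\<exists>P. \<forall>i\<in>{1..n}. a i * P i + eval_at P (b i) = 0"
  using assms
proof (induction n)
  case 0
  show ?case by simp
next
  case (Suc n)
  then obtain P where P: "\<And>i. i \<in> {1..n} \<Longrightarrow> a i * P i + eval_at P (b i) = 0"
    by fastforce
  define Q where "Q = P(Suc n := - eval_at P (b (Suc n)) / a (Suc n))"
  have "eval_at Q (b i) = eval_at P (b i)" if "i \<in> {1..Suc n}" for i
    using that by (intro eval_at_cong[OF Suc.prems(1)[OF that]]) (auto simp: Q_def)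
  then have "a i * Q i + eval_at Q (b i) = 0" if "i \<in> {1..Suc n}" for i
    using that P Suc.prems(2)[OF that] by (cases "i = Suc n") (auto simp: Q_def)
  then show ?case by blast
qed

lemma eval_at_triangular_derivation:
  assumes "\<And>i. i \<in> {1..n} \<Longrightarrow> a i * P i + eval_at P (b i) = 0"
  shows "eval_at P (triangular_derivation n a b f) = 0"
  using assms
  by (simp add: triangular_derivation_def eval_at_sum eval_at_mult eval_at_add
      eval_at_mconst eval_at_mvar)

section \<open>The action on monomials\<close>

text \<open>
  The well-founded lexicographic order on exponent vectors in which the highest variable is the
  most significant: entry \<open>j\<close> of the compared list is the exponent of \<open>x\<^bsub>n-j\<^esub>\<close>.
\<close>

definition lex_below :: "nat \<Rightarrow> ((nat \<Rightarrow>\<^sub>0 nat) \<times> (nat \<Rightarrow>\<^sub>0 nat)) set" where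
  "lex_below n = inv_image (lex less_than) (\<lambda>m. map (\<lambda>j. Poly_Mapping.lookup m (n - j)) [0..<n])"

lemma wf_lex_below: "wf (lex_below n)"
  unfolding lex_below_def by (intro wf_inv_image wf_lex wf_less_than)

lemma lex_belowI:
  assumes i: "i \<in> {1..n}" and less: "Poly_Mapping.lookup u i < Poly_Mapping.lookup m i"
    and eq: "\<And>j. j > i \<Longrightarrow> Poly_Mapping.lookup u j = Poly_Mapping.lookup m j"
  shows "(u, m) \<in> lex_below n"
proof -
  let ?L = "\<lambda>m. map (\<lambda>j. Poly_Mapping.lookup m (n - j)) [0..<n]"
  have "take (n - i) (?L u) = take (n - i) (?L m)"
    using i by (intro nth_equalityI) (auto intro!: eq)
  moreover have "n - i < n" "?L u ! (n - i) < ?L m ! (n - i)"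
    using i less by auto
  ultimately have "?L u = take (n - i) (?L m) @ ?L u ! (n - i) # drop (Suc (n - i)) (?L u)"
    "?L m = take (n - i) (?L m) @ ?L m ! (n - i) # drop (Suc (n - i)) (?L m)"
    "(?L u ! (n - i), ?L m ! (n - i)) \<in> less_than"
    using id_take_nth_drop[of "n - i" "?L u"] id_take_nth_drop[of "n - i" "?L m"] by simp_all
  then have "(?L u, ?L m) \<in> lex less_than"
    unfolding lex_conv by (intro CollectI case_prodI conjI exI) simp_all
  then show ?thesis by (simp add: lex_below_def)
qed

text \<open>
  The terms \<open>a\<^sub>i x\<^sub>i \<partial>\<^sub>i\<close> reproduce the monomial. A term \<open>b\<^sub>i \<partial>\<^sub>i\<close> lowers the exponent of \<open>x\<^sub>i\<close> and
  can raise only those of \<open>x\<^sub>1, \<dots>, x\<^bsub>i-1\<^esub>\<close>, which are less significant.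
\<close>

lemma triangular_derivation_single:
  assumes b: "\<And>i. i \<in> {1..n} \<Longrightarrow> b i \<in> polys_in {1..i - 1}"
  obtains r where
    "triangular_derivation n a b (Poly_Mapping.single m c) =
       Poly_Mapping.single m ((\<Sum>i=1..n. a i * of_nat (Poly_Mapping.lookup m i)) * c) + r"
    "\<And>u. u \<in> Poly_Mapping.keys r \<Longrightarrow> (u, m) \<in> lex_below n"
proof
  let ?e = "\<lambda>i. Poly_Mapping.single i (1::nat)"
  let ?r = "\<Sum>i=1..n. b i * partial i (Poly_Mapping.single m c)"
  have diag: "mconst (a i) * mvar i * partial i (Poly_Mapping.single m c) =
      Poly_Mapping.single m (a i * of_nat (Poly_Mapping.lookup m i) * c)" for i
  proof (cases "Poly_Mapping.lookup m i = 0")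
    case False
    then have "?e i + (m - ?e i) = m"
      by (intro poly_mapping_eqI) (auto simp: lookup_add lookup_minus lookup_single when_def)
    then show ?thesis
      by (simp add: mconst_def mvar_def partial_single mult_single mult.assoc)
  qed (simp add: partial_single)
  show "triangular_derivation n a b (Poly_Mapping.single m c) =
      Poly_Mapping.single m ((\<Sum>i=1..n. a i * of_nat (Poly_Mapping.lookup m i)) * c) + ?r"
  proof -
    have "(\<Sum>i=1..n. Poly_Mapping.single m (f i)) = Poly_Mapping.single m (\<Sum>i=1..n. f i)"
      for f :: "nat \<Rightarrow> 'a"
      by (rule poly_mapping_eqI) (simp add: lookup_sum lookup_single when_def)
    then show ?thesis
      by (simp add: triangular_derivation_def distrib_right sum.distrib diag sum_distrib_right)
  qed
  fix u assume "u \<in> Poly_Mapping.keys ?r"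
  then obtain i where i: "i \<in> {1..n}"
    and u: "u \<in> Poly_Mapping.keys (b i * partial i (Poly_Mapping.single m c))"
    using keys_sum[of "\<lambda>i. b i * partial i (Poly_Mapping.single m c)" "{1..n}"] by blast
  from u obtain v w where uvw: "u = v + w" "v \<in> Poly_Mapping.keys (b i)"
      "w \<in> Poly_Mapping.keys (partial i (Poly_Mapping.single m c))"
    using keys_mult by blast
  have w: "w = m - ?e i" "Poly_Mapping.lookup m i \<noteq> 0"
    using uvw(3) by (auto simp: partial_single split: if_splits intro!: gr0I)
  have v: "Poly_Mapping.lookup v j = 0" if "j \<ge> i" for j
    using b[OF i] uvw(2) that i by (force simp: polys_in_def in_keys_iff)
  show "(u, m) \<in> lex_below n"
    using i v w by (intro lex_belowI[of i])
      (auto simp: uvw(1) lookup_add lookup_minus lookup_single when_def)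
qed

section \<open>The image\<close>

text \<open>
  The exponent vector of a monomial is itself a candidate integral solution, and \<open>D\<close> multiplies
  the monomial, up to smaller terms, by the value of the linear form on that vector.
\<close>

lemma weight_nonzero:
  assumes S: "nonzero_int_solutions n a = {}"
    and "i \<in> {1..n}" "Poly_Mapping.lookup m i \<noteq> 0"
  shows "(\<Sum>i=1..n. a i * of_nat (Poly_Mapping.lookup m i)) \<noteq> 0"
proof
  assume 0: "(\<Sum>i=1..n. a i * of_nat (Poly_Mapping.lookup m i)) = 0"
  define y where "y = restrict (\<lambda>i. int (Poly_Mapping.lookup m i)) {1..n}"
  have "(\<Sum>i=1..n. a i * of_int (y i)) = 0"
    unfolding 0[symmetric] by (intro sum.cong) (auto simp: y_def)
  then have "y \<in> nonzero_int_solutions n a"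
    using assms(2,3) by (auto simp: nonzero_int_solutions_def y_def)
  with S show False by blast
qed

lemma mpol_eq_sum_singles:
  "p = (\<Sum>m\<in>Poly_Mapping.keys p. Poly_Mapping.single m (Poly_Mapping.lookup p m))"
  for p :: "'k::comm_ring_1 mpol"
  by (rule poly_mapping_eqI) (auto simp: lookup_sum lookup_single when_def in_keys_iff)

text \<open>
  By \<open>weight_nonzero\<close>, every nonconstant monomial \<open>x\<^sup>m\<close> has a nonzero diagonal coefficient
  \<open>w\<close>, so \<open>x\<^sup>m\<close> equals \<open>D (x\<^sup>m / w)\<close> up to smaller monomials, which well-founded induction
  handles. What cannot be reached this way is the constant term.
\<close>

lemma constant_modulo_image:
  fixes a :: "nat \<Rightarrow> 'k::field"
  assumes b: "\<And>i. i \<in> {1..n} \<Longrightarrow> b i \<in> polys_in {1..i - 1}"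
    and S: "nonzero_int_solutions n a = {}"
    and f: "f \<in> polys_in {1..n}"
  shows "\<exists>g\<in>polys_in {1..n}. \<exists>d. f = triangular_derivation n a b g + mconst d"
proof -
  let ?D = "triangular_derivation n a b"
  define M where "M = {f. \<exists>g\<in>polys_in {1..n}. \<exists>d. f = ?D g + mconst d}"
  have M_image: "?D g \<in> M" if "g \<in> polys_in {1..n}" for g
    using that unfolding M_def by (auto intro!: bexI[of _ g] exI[of _ 0] simp: mconst_def)
  have M_const: "mconst d \<in> M" for d
    unfolding M_def
    by (auto intro!: bexI[of _ 0] exI[of _ d] simp: triangular_derivation_zero polys_in_zero)
  have M_add: "p + q \<in> M" if pq: "p \<in> M" "q \<in> M" for p q
  proof -
    from pq obtain g h d e where "g \<in> polys_in {1..n}" "h \<in> polys_in {1..n}"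
        "p = ?D g + mconst d" "q = ?D h + mconst e"
      unfolding M_def by blast
    then have "g + h \<in> polys_in {1..n}" "p + q = ?D (g + h) + mconst (d + e)"
      by (simp_all add: polys_in_plus triangular_derivation_add mconst_def single_add)
    then show ?thesis unfolding M_def by blast
  qed
  have M_uminus: "- p \<in> M" if p: "p \<in> M" for p
  proof -
    from p obtain g d where "g \<in> polys_in {1..n}" "p = ?D g + mconst d"
      unfolding M_def by blast
    then have "- g \<in> polys_in {1..n}" "- p = ?D (- g) + mconst (- d)"
      by (simp_all add: polys_in_uminus triangular_derivation_uminus mconst_def single_uminus)
    then show ?thesis unfolding M_def by blast
  qed
  have M_sum: "(\<Sum>i\<in>I. p i) \<in> M" if "\<And>i. i \<in> I \<Longrightarrow> p i \<in> M" for p and I :: "(nat \<Rightarrow>\<^sub>0 nat) set"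
    using that M_const[of 0]
    by (induction I rule: infinite_finite_induct) (simp_all add: M_add mconst_def)
  have M_single: "Poly_Mapping.single m c \<in> M" if "Poly_Mapping.keys m \<subseteq> {1..n}" for m c
    using that
  proof (induction m arbitrary: c rule: wf_induct_rule[OF wf_lex_below[of n]])
    case (1 m)
    show ?case
    proof (cases "m = 0")
      case True
      then show ?thesis using M_const[of c] by (simp add: mconst_def)
    next
      case False
      define w where "w = (\<Sum>i=1..n. a i * of_nat (Poly_Mapping.lookup m i))"
      from False obtain i where "i \<in> Poly_Mapping.keys m" by fastforce
      then have "i \<in> {1..n}" "Poly_Mapping.lookup m i \<noteq> 0"
        using 1(2) by (blast, simp add: in_keys_iff)
      then have w: "w \<noteq> 0" unfolding w_def by (rule weight_nonzero[OF S])
      let ?g = "Poly_Mapping.single m (c / w)"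
      obtain r where r: "?D ?g = Poly_Mapping.single m (w * (c / w)) + r"
        "\<And>u. u \<in> Poly_Mapping.keys r \<Longrightarrow> (u, m) \<in> lex_below n"
        using triangular_derivation_single[of n b a m "c / w"] b unfolding w_def[symmetric] by blast
      have g: "?g \<in> polys_in {1..n}" using 1(2) by (rule polys_in_single)
      have eq: "Poly_Mapping.single m c = ?D ?g + - r" using w r(1) by simp
      have "r = ?D ?g + - Poly_Mapping.single m c" using w r(1) by simp
      then have "r \<in> polys_in {1..n}"
        using polys_in_triangular_derivation[OF b g, of a] polys_in_single[OF 1(2), of c]
        by (simp only: polys_in_plus polys_in_uminus)
      then have "Poly_Mapping.keys u \<subseteq> {1..n}" if "u \<in> Poly_Mapping.keys r" for u
        using that by (auto simp only: polys_in_def)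
      then have "r \<in> M"
        by (subst mpol_eq_sum_singles) (intro M_sum 1(1) r(2))
      then show ?thesis unfolding eq by (intro M_add M_uminus M_image g)
    qed
  qed
  have "Poly_Mapping.keys m \<subseteq> {1..n}" if "m \<in> Poly_Mapping.keys f" for m
    using f that by (auto simp only: polys_in_def)
  then have "f \<in> M"
    by (subst mpol_eq_sum_singles) (intro M_sum M_single)
  then show ?thesis by (simp add: M_def)
qed

theorem proposition2p6:
  fixes n :: nat
    and a :: "nat \<Rightarrow> 'k::{alg_closed_field, field_char_0}"
    and b :: "nat \<Rightarrow> 'k mpol"
    and D :: "'k mpol \<Rightarrow> 'k mpol"
  assumes b: "\<And>i. i \<in> {1..n} \<Longrightarrow> b i \<in> polys_in {1..i - 1}"
    and D: "\<And>f. f \<in> carrier (mpoly_ring n) \<Longrightarrow>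
              D f = (\<Sum>i=1..n. (mconst (a i) * mvar i + b i) * partial i f)"
    and S: "nonzero_int_solutions n a = {}"
  shows "ideal (D ` carrier (mpoly_ring n)) (mpoly_ring n)"
proof -
  let ?D = "triangular_derivation n a b"
  have carrier: "carrier (mpoly_ring n) = (polys_in {1..n} :: 'k mpol set)"
    by (simp add: mpoly_ring_def)
  have D_eq: "D f = ?D f" if "f \<in> polys_in {1..n}" for f
    using D that by (simp add: carrier triangular_derivation_def)
  have a: "a i \<noteq> 0" if i: "i \<in> {1..n}" for i
  proof -
    have "(\<Sum>j=1..n. a j * of_nat (Poly_Mapping.lookup (Poly_Mapping.single i 1) j)) = a i"
      using i by (simp add: lookup_single when_def if_distrib cong: if_cong)
    with weight_nonzero[OF S i, of "Poly_Mapping.single i 1"] show ?thesis by simp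
  qed
  obtain P where P: "\<And>i. i \<in> {1..n} \<Longrightarrow> a i * P i + eval_at P (b i) = 0"
    using triangular_field_has_zero[of n b a] b a by blast
  have zero: "eval_at P (?D g) = 0" for g
    by (rule eval_at_triangular_derivation[OF P])
  have "D ` polys_in {1..n} = {f \<in> polys_in {1..n}. eval_at P f = 0}"
  proof (intro equalityI subsetI)
    fix f assume "f \<in> D ` polys_in {1..n}"
    then show "f \<in> {f \<in> polys_in {1..n}. eval_at P f = 0}"
      using D_eq zero polys_in_triangular_derivation[OF b] by auto
  next
    fix f assume f: "f \<in> {f \<in> polys_in {1..n}. eval_at P f = 0}"
    then obtain g d where g: "g \<in> polys_in {1..n}" and fg: "f = ?D g + mconst d"
      using constant_modulo_image[OF b S] by blast
    have "d = eval_at P f" by (simp add: fg eval_at_add zero eval_at_mconst)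
    with f have "d = 0" by simp
    with fg have "f = D g" by (simp add: D_eq[OF g] mconst_def)
    with g show "f \<in> D ` polys_in {1..n}" by blast
  qed
  then show ?thesis
    using vanishing_ideal[of n P] by (simp add: carrier)
qed

end
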